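(* Let $\mathbf{u}$ be an infinite word over a finite alphabet whose language $\mathcal{L}(\mathbf{u})$ is closed under reversal. Then $\mathbf{u}$ is rich if and only if every bispecial factor $w$ of $\mathbf{u}$ satisfies: (1) if $w$ is not a palindrome, then $\mathrm{b}(w)=0$; (2) if $w$ is a palindrome, then $\mathrm{b}(w)=\#\mathrm{Pext}(w)-1$.
   Context: An infinite word over a finite alphabet $\mathcal{A}$ is a one-sided infinite sequence $\mathbf{u}=u_0u_1u_2\ldots$ of letters of $\mathcal{A}$ in which every letter of $\mathcal{A}$ occurs. Its language $\mathcal{L}(\mathbf{u})$ is the set of all its finite factors (contiguous subwords), including the empty word $\varepsilon$. The reversal of $w=w_0\cdots w_{n-1}$ is $\overline{w}=w_{n-1}\cdots w_0$; $w$ is a palindrome if $w=\overline{w}$ (the empty word is a palindrome). $\mathcal{L}(\mathbf{u})$ is closed under reversal if $w\in\mathcal{L}(\mathbf{u})$ implies $\overline{w}\in\mathcal{L}(\mathbf{u})$. For $w\in\mathcal{L}(\mathbf{u})$: $\mathrm{Lext}(w)=\{a\in\mathcal{A}: aw\in\mathcal{L}(\mathbf{u})\}$, $\mathrm{Rext}(w)=\{a\in\mathcal{A}: wa\in\mathcal{L}(\mathbf{u})\}$, $\mathrm{Bext}(w)=\{awb\in\mathcal{L}(\mathbf{u}): a,b\in\mathcal{A}\}$. A factor $w$ is bispecial if $\#\mathrm{Lext}(w)\ge 2$ and $\#\mathrm{Rext}(w)\ge 2$. The bilateral order of $w$ is $\mathrm{b}(w)=\#\mathrm{Bext}(w)-\#\mathrm{Rext}(w)-\#\mathrm{Lext}(w)+1$.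 For a palindrome $w$, $\mathrm{Pext}(w)=\{awa\in\mathcal{L}(\mathbf{u}): a\in\mathcal{A}\}$. $\mathbf{u}$ is rich if every factor $w$ of $\mathbf{u}$ contains exactly $|w|+1$ distinct palindromic factors (including the empty word). *)

theory Defs
  imports "HOL-Library.Sublist"
begin

text \<open>Infinite words are functions \<open>u :: nat \<Rightarrow> 'a\<close>, finite words are lists. The alphabet \<open>A\<close> is a
  finite set of letters, all of which occur in \<open>u\<close>.\<close>

definition infinite_word :: "'a set \<Rightarrow> (nat \<Rightarrow> 'a) \<Rightarrow> bool" where
  "infinite_word A u \<longleftrightarrow> finite A \<and> range u = A"

text \<open>The empty word belongs to the language (take \<open>i = j\<close>).\<close>

definition language :: "(nat \<Rightarrow> 'a) \<Rightarrow> 'a list set" where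
  "language u = {map u [i..<j] | i j. i \<le> j}"

definition palindrome :: "'a list \<Rightarrow> bool" where
  "palindrome w \<longleftrightarrow> rev w = w"

definition closed_under_reversal :: "'a list set \<Rightarrow> bool" where
  "closed_under_reversal L \<longleftrightarrow> (\<forall>w\<in>L. rev w \<in> L)"

definition Lext :: "'a set \<Rightarrow> (nat \<Rightarrow> 'a) \<Rightarrow> 'a list \<Rightarrow> 'a set" where
  "Lext A u w = {a \<in> A. a # w \<in> language u}"

definition Rext :: "'a set \<Rightarrow> (nat \<Rightarrow> 'a) \<Rightarrow> 'a list \<Rightarrow> 'a set" where
  "Rext A u w = {a \<in> A. w @ [a] \<in> language u}"

definition Bext :: "'a set \<Rightarrow> (nat \<Rightarrow> 'a) \<Rightarrow> 'a list \<Rightarrow> 'a list set" where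
  "Bext A u w = {a # w @ [b] | a b. a \<in> A \<and> b \<in> A \<and> a # w @ [b] \<in> language u}"

definition Pext :: "'a set \<Rightarrow> (nat \<Rightarrow> 'a) \<Rightarrow> 'a list \<Rightarrow> 'a list set" where
  "Pext A u w = {a # w @ [a] | a. a \<in> A \<and> a # w @ [a] \<in> language u}"

definition bispecial :: "'a set \<Rightarrow> (nat \<Rightarrow> 'a) \<Rightarrow> 'a list \<Rightarrow> bool" where
  "bispecial A u w \<longleftrightarrow> w \<in> language u \<and> card (Lext A u w) \<ge> 2 \<and> card (Rext A u w) \<ge> 2"

text \<open>The bilateral order may be negative, hence the integers.\<close>

definition bilateral_order :: "'a set \<Rightarrow> (nat \<Rightarrow> 'a) \<Rightarrow> 'a list \<Rightarrow> int" where
  "bilateral_order A u w =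
     int (card (Bext A u w)) - int (card (Rext A u w)) - int (card (Lext A u w)) + 1"

text \<open>\<open>sublist\<close> is the contiguous-factor relation on lists; the empty palindrome is counted.\<close>

definition rich :: "(nat \<Rightarrow> 'a) \<Rightarrow> bool" where
  "rich u \<longleftrightarrow> (\<forall>w\<in>language u. card {p. sublist p w \<and> palindrome p} = length w + 1)"

end

theory Submission
  imports Defs
begin

text \<open>Identify every word with its reversal and let \<open>\<Gamma>\<^sub>n\<close> be the graph whose vertices are the
  classes of factors of length \<open>n\<close> and whose edges are the classes of factors of length \<open>n + 1\<close>; its
  loops are exactly the palindromes. Reading \<open>u\<close> from left to right is a walk through
  \<open>\<Gamma>\<^sub>n\<close> that uses all vertices and edges. For such a walk the number of edges other than loops is
  one less than the number of vertices if and only if the first return to a vertex always happens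
  through the edge by which the walk left it.

  Summing the conditions on the bilateral orders of all words of length \<open>n\<close> computes the second
  difference of the factor complexity and yields, by induction on \<open>n\<close>, the edge count of a tree for
  every \<open>\<Gamma>\<^sub>n\<close>. The return property of these walks forces complete returns to palindromes to be
  palindromes, which is richness.

  Conversely, in a rich word the factor from one occurrence of \<open>w\<close> or \<open>rev w\<close> to the next is a
  palindrome. Hence the successive occurrences form a walk on the graph with edges \<open>awb\<close> and
  vertices \<open>aw\<close>, \<open>wb\<close>, and this walk has the return property. Counting its edges and vertices
  gives the bilateral order of \<open>w\<close>.\<close>

section \<open>Walks and trees\<close>

text \<open>Labels determine their ends only on steps that change the vertex. Idle steps at
  different vertices may therefore share one label, as they do in the walk along the occurrences of
  a factor.\<close>

locale walk =
  fixes v :: "nat \<Rightarrow> 'v" and e :: "nat \<Rightarrow> 'e"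
  assumes edge_ends: "\<And>i j. e i = e j \<Longrightarrow> v i \<noteq> v (Suc i) \<Longrightarrow> {v i, v (Suc i)} = {v j, v (Suc j)}"
    and finite_vertices: "finite (range v)"
    and finite_edges: "finite (range e)"
begin

definition proper_edges :: "'e set" where
  "proper_edges = e ` {i. v i \<noteq> v (Suc i)}"

definition backtracking :: bool where
  "backtracking \<longleftrightarrow> (\<forall>k j. k < j \<longrightarrow> v k \<noteq> v (Suc k) \<longrightarrow> v j = v k \<longrightarrow>
     (\<forall>i. k < i \<and> i < j \<longrightarrow> v i \<noteq> v k) \<longrightarrow> e (j - 1) = e k)"

definition first :: "'v \<Rightarrow> nat" where
  "first x = (LEAST i. v i = x)"

text \<open>The steps that enter a vertex for the first time form a spanning tree rooted at
  \<open>v 0\<close>. At the root \<open>first x - 1\<close> is truncated to 0, so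
  \<open>parent\<close> and \<open>entry\<close> are meaningful only for
  \<open>x \<noteq> v 0\<close>.\<close>

definition parent :: "'v \<Rightarrow> 'v" where
  "parent x = v (first x - 1)"

definition entry :: "'v \<Rightarrow> 'e" where
  "entry x = e (first x - 1)"

lemma v_first: "x \<in> range v \<Longrightarrow> v (first x) = x"
  unfolding first_def by (rule LeastI_ex) auto

lemma first_le: "v i = x \<Longrightarrow> first x \<le> i"
  unfolding first_def by (rule Least_le)

lemma first_pos: "x \<in> range v \<Longrightarrow> x \<noteq> v 0 \<Longrightarrow> Suc (first x - 1) = first x"
  using v_first[of x] by (cases "first x") auto

lemma first_parent:
  assumes "x \<in> range v" "x \<noteq> v 0"
  shows "first (parent x) < first x"
  using first_le[of "first x - 1" "parent x"] first_pos[OF assms] by (simp add: parent_def)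

lemma parent_neq: "x \<in> range v \<Longrightarrow> x \<noteq> v 0 \<Longrightarrow> parent x \<noteq> x"
  using first_parent by fastforce

lemma entry_ends:
  assumes "x \<in> range v" "x \<noteq> v 0" "e i = entry x"
  shows "{v i, v (Suc i)} = {parent x, x}"
proof -
  have "v (Suc (first x - 1)) = x"
    using first_pos[OF assms(1,2)] v_first[OF assms(1)] by simp
  then show ?thesis
    using edge_ends[of "first x - 1" i] parent_neq[OF assms(1,2)] assms(3)
    unfolding entry_def parent_def by simp
qed

lemma entry_proper:
  assumes "x \<in> range v" "x \<noteq> v 0"
  shows "entry x \<in> proper_edges"
proof -
  have "v (Suc (first x - 1)) = x"
    using first_pos[OF assms] v_first[OF assms(1)] by simp
  then show ?thesis
    using parent_neq[OF assms] unfolding proper_edges_def entry_def parent_def by auto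
qed

text \<open>Vertices with a common entry edge are equal or parents of each other, and a parent is
  visited strictly earlier than its child.\<close>

lemma inj_on_entry: "inj_on entry (range v - {v 0})"
proof (rule inj_onI)
  fix x y assume x: "x \<in> range v - {v 0}" and y: "y \<in> range v - {v 0}" and eq: "entry x = entry y"
  have "{parent x, x} = {parent y, y}"
    using entry_ends[of x "first x - 1"] entry_ends[of y "first x - 1"] x y eq
    by (simp add: entry_def)
  then show "x = y"
    using first_parent[of x] first_parent[of y] x y by (auto simp: doubleton_eq_iff)
qed

lemma finite_proper_edges: "finite proper_edges"
  unfolding proper_edges_def by (rule finite_subset[OF _ finite_edges]) auto

text \<open>By injectivity the spanning tree has one edge fewer than there are vertices, so the
  count holds iff no proper edge lies outside it.\<close>

lemma entry_surj_iff:
  "entry ` (range v - {v 0}) = proper_edges \<longleftrightarrow> Suc (card proper_edges) = card (range v)"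
proof -
  have c: "Suc (card (entry ` (range v - {v 0}))) = card (range v)"
    unfolding card_image[OF inj_on_entry] by (rule card_Suc_Diff1[OF finite_vertices rangeI])
  have "entry ` (range v - {v 0}) \<subseteq> proper_edges"
    using entry_proper by auto
  then show ?thesis
    using c card_subset_eq[OF finite_proper_edges] by (metis nat.inject)
qed

text \<open>The first use of a proper edge reaches a new vertex: a return would go through the edge
  by which the walk last left that vertex, so the edge would have been used before.\<close>

lemma backtracking_imp_entry_surj:
  assumes backtracking
  shows "entry ` (range v - {v 0}) = proper_edges"
proof
  show "entry ` (range v - {v 0}) \<subseteq> proper_edges"
    using entry_proper by auto
  show "proper_edges \<subseteq> entry ` (range v - {v 0})"
  proof
    fix x assume "x \<in> proper_edges"
    then obtain i0 where i0: "v i0 \<noteq> v (Suc i0)" "x = e i0"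
      unfolding proper_edges_def by auto
    define i where "i = (LEAST i. e i = x)"
    have i: "e i = x" unfolding i_def by (rule LeastI[of _ i0]) (use i0 in simp)
    have least: "i \<le> j" if "e j = x" for j unfolding i_def using that by (rule Least_le)
    have ni: "v i \<noteq> v (Suc i)" using edge_ends[of i0 i] i0 i by auto
    have new: "v k \<noteq> v (Suc i)" if "k \<le> i" for k
    proof
      assume k: "v k = v (Suc i)"
      \<comment> \<open>The last visit to the far end up to time \<open>i\<close>, which makes
        \<open>Suc i\<close> the first return after \<open>m\<close>.\<close>
      define m where "m = (GREATEST k. k \<le> i \<and> v k = v (Suc i))"
      have m: "m \<le> i \<and> v m = v (Suc i)"
        unfolding m_def by (rule GreatestI_nat[of _ k i]) (use k that in auto)
      have gr: "l \<le> m" if "l \<le> i" "v l = v (Suc i)" for l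
        unfolding m_def by (rule Greatest_le_nat[of _ l i]) (use that in auto)
      have "m < i" using m ni by (cases "m = i") auto
      moreover have "v m \<noteq> v (Suc m)" using gr[of "Suc m"] m \<open>m < i\<close> by auto
      moreover have "\<forall>l. m < l \<and> l < Suc i \<longrightarrow> v l \<noteq> v m" using gr m by (auto simp: less_Suc_eq_le dest: leD)
      ultimately have "e (Suc i - 1) = e m"
        by (intro \<open>backtracking\<close>[unfolded backtracking_def, rule_format]) (use m in auto)
      then show False using least[of m] \<open>m < i\<close> i by simp
    qed
    have "first (v (Suc i)) = Suc i"
    proof (rule antisym)
      show "first (v (Suc i)) \<le> Suc i" by (rule first_le) simp
      show "Suc i \<le> first (v (Suc i))"
        using new[of "first (v (Suc i))"] v_first[OF rangeI, of "Suc i"] by (meson not_less_eq_eq)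
    qed
    then have "entry (v (Suc i)) = x" unfolding entry_def using i by simp
    then show "x \<in> entry ` (range v - {v 0})" using new[of 0] by force
  qed
qed

inductive_set descendants :: "'v \<Rightarrow> 'v set" for y where
  self: "y \<in> descendants y"
| child: "parent z \<in> descendants y \<Longrightarrow> z \<in> range v \<Longrightarrow> z \<noteq> v 0 \<Longrightarrow> z \<in> descendants y"

lemma first_descendants: "z \<in> descendants y \<Longrightarrow> first y \<le> first z"
proof (induction rule: descendants.induct)
  case (child z)
  then show ?case using first_parent[of z] by simp
qed simp

text \<open>Deleting the edge by which \<open>y\<close> was entered separates the descendants of \<open>y\<close> from the
  rest of the tree.\<close>

lemma entry_surj_imp_backtracking:
  assumes surj: "entry ` (range v - {v 0}) = proper_edges"
  shows backtracking
  unfolding backtracking_def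
proof (intro allI impI)
  fix k j assume kj: "k < j" and nk: "v k \<noteq> v (Suc k)" and ret: "v j = v k"
    and between: "\<forall>i. k < i \<and> i < j \<longrightarrow> v i \<noteq> v k"
  show "e (j - 1) = e k"
  proof (rule ccontr)
    assume ne: "e (j - 1) \<noteq> e k"
    have "e k \<in> proper_edges" unfolding proper_edges_def using nk by auto
    then obtain y where y: "y \<in> range v" "y \<noteq> v 0" "e k = entry y"
      using surj by auto
    have ends: "{v k, v (Suc k)} = {parent y, y}" using entry_ends[OF y] .
    have pn: "parent y \<notin> descendants y"
      using first_descendants[of "parent y" y] first_parent[OF y(1,2)] by auto
    \<comment> \<open>Any other proper edge is the entry edge of some \<open>z \<noteq> y\<close>.
      It joins \<open>z\<close> to its parent, and these lie on the same side of the cut.\<close>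
    have step: "v i \<in> descendants y \<longleftrightarrow> v (Suc i) \<in> descendants y" if "e i \<noteq> e k" for i
    proof (cases "v i = v (Suc i)")
      case False
      then have "e i \<in> proper_edges" unfolding proper_edges_def by auto
      then obtain z where z: "z \<in> range v" "z \<noteq> v 0" "e i = entry z"
        using surj by auto
      have "z \<noteq> y" using z y that by auto
      have "z \<in> descendants y \<longleftrightarrow> parent z \<in> descendants y"
      proof
        assume "z \<in> descendants y"
        then show "parent z \<in> descendants y" using \<open>z \<noteq> y\<close> by cases auto
      qed (rule descendants.child[OF _ z(1,2)])
      then show ?thesis using entry_ends[OF z] by (auto simp: doubleton_eq_iff)
    qed simp
    \<comment> \<open>A further use of \<open>e k\<close> would touch \<open>v k\<close>, hence be
      the step that arrives at time \<open>j\<close>; \<open>ne\<close> excludes this.\<close>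
    have avoid: "e i \<noteq> e k" if "k < i" "i < j" for i
    proof
      assume "e i = e k"
      then have "v k \<in> {v i, v (Suc i)}" using edge_ends[of k i] nk by auto
      then have "Suc i = j" using between[rule_format, of i] between[rule_format, of "Suc i"] that by force
      then show False using \<open>e i = e k\<close> ne by auto
    qed
    have "v (Suc k) \<in> descendants y \<longleftrightarrow> v (Suc k + d) \<in> descendants y" if "Suc k + d \<le> j" for d
      using that
    proof (induction d)
      case (Suc d)
      then show ?case using step[OF avoid, of "Suc k + d"] by simp
    qed simp
    \<comment> \<open>Both ends of the edge \<open>e k\<close> now lie on one side, although one is
      \<open>y\<close> and the other its parent.\<close>
    from this[of "j - Suc k"] have "v (Suc k) \<in> descendants y \<longleftrightarrow> v k \<in> descendants y"
      using kj ret by simp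
    then show False using ends pn descendants.self[of y] by (auto simp: doubleton_eq_iff)
  qed
qed

theorem backtracking_iff: "backtracking \<longleftrightarrow> Suc (card proper_edges) = card (range v)"
  using backtracking_imp_entry_surj entry_surj_imp_backtracking entry_surj_iff by blast

end

section \<open>Factors and palindromes\<close>

definition fac :: "(nat \<Rightarrow> 'a) \<Rightarrow> nat \<Rightarrow> nat \<Rightarrow> 'a list" where
  "fac u i n = map u [i..<i + n]"

lemma length_fac [simp]: "length (fac u i n) = n"
  by (simp add: fac_def)

lemma fac_add: "fac u i (m + n) = fac u i m @ fac u (i + m) n"
proof -
  have "[i..<i + (m + n)] = [i..<i + m] @ [i + m..<i + m + n]"
    using upt_add_eq_append[of i "i + m" n] by (simp add: add.assoc)
  then show ?thesis by (simp add: fac_def)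
qed

lemma fac_0 [simp]: "fac u i 0 = []"
  by (simp add: fac_def)

lemma fac_1: "fac u i (Suc 0) = [u i]"
  by (simp add: fac_def)

lemma fac_Suc: "fac u i (Suc n) = u i # fac u (Suc i) n"
  using fac_add[of u i 1 n] by (simp add: fac_1)

lemma fac_Suc_snoc: "fac u i (Suc n) = fac u i n @ [u (i + n)]"
  using fac_add[of u i n 1] by (simp add: fac_1)

lemma take_fac: "k \<le> n \<Longrightarrow> take k (fac u i n) = fac u i k"
  using fac_add[of u i k "n - k"] by simp

lemma drop_fac: "k \<le> n \<Longrightarrow> drop k (fac u i n) = fac u (i + k) (n - k)"
  using fac_add[of u i k "n - k"] by simp

lemma tl_fac [simp]: "tl (fac u i (Suc n)) = fac u (Suc i) n"
  by (simp add: fac_Suc)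

lemma butlast_fac [simp]: "butlast (fac u i (Suc n)) = fac u i n"
  by (simp add: fac_Suc_snoc)

lemma language_eq: "language u = {fac u i n | i n. True}"
proof -
  have "map u [i..<j] = fac u i (j - i)" if "i \<le> j" for i j
    using that by (simp add: fac_def)
  moreover have "\<exists>k j. fac u i n = map u [k..<j] \<and> k \<le> j" for i n
    unfolding fac_def by (metis le_add1)
  ultimately show ?thesis
    unfolding language_def by blast
qed

lemma fac_in_language [simp]: "fac u i n \<in> language u"
  by (auto simp: language_eq)

lemma languageE:
  assumes "w \<in> language u"
  obtains i where "w = fac u i (length w)"
  using assms by (auto simp: language_eq)

lemma sublist_fac:
  assumes "sublist p (fac u i n)"
  obtains s where "p = fac u s (length p)" "i \<le> s" "s + length p \<le> i + n"
proof -
  obtain xs ys where *: "fac u i n = xs @ p @ ys"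
    using assms by (auto simp: sublist_def)
  have len: "n = length xs + (length p + length ys)"
    using arg_cong[OF *, of length] by simp
  have "p = take (length p) (drop (length xs) (fac u i n))"
    using * by simp
  also have "\<dots> = fac u (i + length xs) (length p)"
    using len by (simp add: drop_fac take_fac)
  finally show thesis
    using that[of "i + length xs"] len by simp
qed

lemma sublist_in_language: "w \<in> language u \<Longrightarrow> sublist p w \<Longrightarrow> p \<in> language u"
  by (metis fac_in_language languageE sublist_fac)

lemma Cons_in_languageD: "a # w \<in> language u \<Longrightarrow> w \<in> language u"
  by (rule sublist_in_language[of "a # w"]) (auto intro: suffix_imp_sublist suffix_ConsI)

lemma snoc_in_languageD: "w @ [a] \<in> language u \<Longrightarrow> w \<in> language u"
  by (rule sublist_in_language[of "w @ [a]"]) auto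

lemma sublist_fac_fac: "i \<le> s \<Longrightarrow> s + m \<le> i + n \<Longrightarrow> sublist (fac u s m) (fac u i n)"
proof -
  assume a: "i \<le> s" "s + m \<le> i + n"
  have "fac u i n = fac u i (s - i) @ fac u s m @ fac u (s + m) (i + n - (s + m))"
    using fac_add[of u i "s - i" "m + (i + n - (s + m))"] fac_add[of u s m "i + n - (s + m)"] a
    by simp
  then show ?thesis by (metis sublist_appendI)
qed

lemma palindrome_fac_ends:
  assumes "rev (fac u i l) = fac u i l" "m \<le> l"
  shows "fac u (i + l - m) m = rev (fac u i m)"
proof -
  have "fac u (i + l - m) m = drop (l - m) (fac u i l)"
    using assms(2) by (simp add: drop_fac)
  also have "\<dots> = drop (l - m) (rev (fac u i l))"
    using assms(1) by simp
  also have "\<dots> = rev (fac u i m)"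
    using assms(2) by (simp add: drop_rev take_fac)
  finally show ?thesis .
qed

section \<open>Words up to reversal\<close>

definition cls :: "'a list \<Rightarrow> 'a list set" where
  "cls w = {w, rev w}"

lemma cls_eq_iff: "cls x = cls y \<longleftrightarrow> x = y \<or> x = rev y"
  by (auto simp: cls_def doubleton_eq_iff)

lemma cls_rev [simp]: "cls (rev x) = cls x"
  by (simp add: cls_eq_iff)

text \<open>Reversal interchanges \<open>butlast\<close> and \<open>tl\<close> up to reversal, so
  the class of a word determines an unordered pair of end classes, as an edge must.\<close>

lemma cls_ends:
  assumes "cls y = cls z"
  shows "{cls (butlast y), cls (tl y)} = {cls (butlast z), cls (tl z)}"
proof -
  have "butlast (rev z) = rev (tl z)" "tl (rev z) = rev (butlast z)"
    by (induction z rule: rev_induct) (auto simp: butlast_rev)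
  then show ?thesis using assms by (auto simp: cls_eq_iff)
qed

text \<open>For nonempty \<open>w\<close>, comparing first letters and last letters shows that
  \<open>a\<close> and \<open>b\<close> are both the last letter of \<open>w\<close>.\<close>

lemma Cons_eq_rev_snoc: "a # w = rev w @ [b] \<Longrightarrow> a = b"
  by (cases w rule: rev_cases) auto

lemma Cons_eq_snoc_imp_rev: "a # w = w @ [b] \<Longrightarrow> rev w = w"
proof -
  assume "a # w = w @ [b]"
  moreover have "a # w = w @ [b] \<Longrightarrow> w = replicate (length w) a"
    by (induction w) auto
  ultimately show ?thesis by (metis rev_replicate)
qed

text \<open>This identifies loops with palindromes. If the two ends are equal words,
  \<open>z\<close> is a power of one letter; if they are reversals of each other, the outer letters
  agree.\<close>

lemma cls_butlast_eq_cls_tl_iff: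
  assumes "z \<noteq> []"
  shows "cls (butlast z) = cls (tl z) \<longleftrightarrow> rev z = z"
proof
  assume "rev z = z"
  moreover have "butlast (rev z) = rev (tl z)"
    by (simp add: butlast_rev)
  ultimately show "cls (butlast z) = cls (tl z)"
    by (simp add: cls_eq_iff)
next
  assume c: "cls (butlast z) = cls (tl z)"
  obtain a y where z: "z = a # y" using assms by (cases z) auto
  obtain x b where z': "z = x @ [b]" using assms by (cases z rule: rev_cases) auto
  from c have "x = y \<or> x = rev y" by (metis butlast_snoc cls_eq_iff list.sel(3) z z')
  then show "rev z = z"
  proof
    assume "x = y"
    then have "a # x = x @ [b]" using z z' by simp
    then have "rev x = x" by (rule Cons_eq_snoc_imp_rev)
    moreover have "a = b" using Cons_eq_rev_snoc[of a x b] \<open>a # x = x @ [b]\<close> \<open>rev x = x\<close> by simp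
    ultimately show ?thesis using z z' \<open>x = y\<close> by (metis rev.simps(2))
  next
    assume x: "x = rev y"
    then have "a = b" using Cons_eq_rev_snoc[of a y b] z z' by simp
    then show ?thesis using z z' x by simp
  qed
qed

lemma card_cls_image_palindromes: "card (cls ` {z \<in> S. rev z = z}) = card {z \<in> S. rev z = z}"
  by (rule card_image) (auto simp: inj_on_def cls_def)

lemma card_cls_image_non_palindromes:
  assumes "finite S" and "\<And>z. z \<in> S \<Longrightarrow> rev z \<in> S"
  shows "2 * card (cls ` {z \<in> S. rev z \<noteq> z}) = card {z \<in> S. rev z \<noteq> z}"
proof -
  let ?T = "{z \<in> S. rev z \<noteq> z}"
  have U: "\<Union> (cls ` ?T) = ?T"
    using assms(2) by (auto simp: cls_def)
  have "2 * card (cls ` ?T) = card (\<Union> (cls ` ?T))"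
  proof (rule card_partition)
    show "finite (\<Union> (cls ` ?T))" using assms(1) unfolding U by simp
  qed (use assms(1) in \<open>auto simp: cls_def\<close>)
  then show ?thesis unfolding U .
qed

lemma card_non_palindromes:
  assumes "finite S"
  shows "card S = card {z \<in> S. rev z \<noteq> z} + card {z \<in> S. rev z = z}"
proof -
  have "card ({z \<in> S. rev z \<noteq> z} \<union> {z \<in> S. rev z = z}) = card {z \<in> S. rev z \<noteq> z} + card {z \<in> S. rev z = z}"
    by (rule card_Un_disjoint) (use assms in auto)
  moreover have "{z \<in> S. rev z \<noteq> z} \<union> {z \<in> S. rev z = z} = S"
    by auto
  ultimately show ?thesis by simp
qed

text \<open>A palindrome is a class of its own, while the other words are paired with their
  reversals.\<close>

lemma card_cls_image:
  assumes "finite S" and "\<And>z. z \<in> S \<Longrightarrow> rev z \<in> S"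
  shows "2 * card (cls ` S) = card S + card {z \<in> S. rev z = z}"
proof -
  let ?P = "{z \<in> S. rev z = z}" and ?N = "{z \<in> S. rev z \<noteq> z}"
  have "cls ` ?N \<inter> cls ` ?P = {}" by (auto simp: cls_eq_iff)
  moreover have "cls ` S = cls ` ?N \<union> cls ` ?P" by auto
  ultimately have "card (cls ` S) = card (cls ` ?N) + card (cls ` ?P)"
    using assms(1) by (simp add: card_Un_disjoint)
  then show ?thesis
    using card_non_palindromes[OF assms(1)] card_cls_image_non_palindromes[OF assms] card_cls_image_palindromes[of S] by simp
qed

section \<open>Palindromic factors and complete returns\<close>

definition pals :: "'a list \<Rightarrow> 'a list set" where
  "pals w = {p. sublist p w \<and> palindrome p}"

lemma finite_pals: "finite (pals w)"
proof -
  have "finite {p. sublist p w}"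
    by (metis finite_set set_sublists_eq)
  then show ?thesis unfolding pals_def by (rule rev_finite_subset) auto
qed

text \<open>Reflection in the longer palindrome \<open>q\<close> turns its suffix \<open>p\<close>
  into a prefix, which ends before the last letter.\<close>

lemma shorter_palindromic_suffix_old:
  assumes "suffix p (r @ [a])" "suffix q (r @ [a])" "palindrome p" "palindrome q"
    and "length p < length q"
  shows "sublist p r"
proof -
  have "suffix p q"
    using assms(1,2,5) suffix_length_suffix by fastforce
  then have "prefix p q"
    using assms(3,4) by (simp add: palindrome_def suffix_to_prefix)
  then obtain s where s: "q = p @ s" by (auto simp: prefix_def)
  then have "s \<noteq> []" using assms(5) by auto
  then obtain s' b where "s = s' @ [b]" by (cases s rule: rev_cases) auto
  moreover obtain t where "r @ [a] = t @ q" using assms(2) by (auto simp: suffix_def)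
  ultimately have "r = t @ p @ s'" using s by simp
  then show ?thesis by (metis sublist_appendI)
qed

text \<open>Only the longest palindromic suffix can be new, so a letter adds at most one
  palindrome.\<close>

lemma card_pals_snoc:
  "card (pals (r @ [a])) = card (pals r) +
    (if \<exists>p. suffix p (r @ [a]) \<and> palindrome p \<and> \<not> sublist p r then 1 else 0)"
proof -
  let ?N = "{p. suffix p (r @ [a]) \<and> palindrome p \<and> \<not> sublist p r}"
  have un: "pals (r @ [a]) = pals r \<union> ?N"
    by (auto simp: pals_def sublist_snoc)
  have "pals r \<inter> ?N = {}" by (auto simp: pals_def)
  moreover have "finite ?N" using finite_pals[of "r @ [a]"] unfolding un by simp
  ultimately have c: "card (pals (r @ [a])) = card (pals r) + card ?N"
    unfolding un by (simp add: card_Un_disjoint finite_pals)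
  show ?thesis
  proof (cases "?N = {}")
    case False
    then obtain p where p: "p \<in> ?N" by blast
    have "q = p" if "q \<in> ?N" for q
    proof -
      have "length q = length p"
        using shorter_palindromic_suffix_old[of p r a q] shorter_palindromic_suffix_old[of q r a p] p that
        by (auto intro: linorder_neqE_nat)
      then show ?thesis using p that by (auto simp: suffix_def)
    qed
    then have "?N = {p}" using p by blast
    then have "card ?N = 1" by (metis card.empty card_insert_disjoint empty_iff finite.emptyI One_nat_def)
    moreover have "\<exists>p. suffix p (r @ [a]) \<and> palindrome p \<and> \<not> sublist p r" using p by blast
    ultimately show ?thesis using c by presburger
  next
    case True
    then have "\<nexists>p. suffix p (r @ [a]) \<and> palindrome p \<and> \<not> sublist p r" by blast
    moreover have "card ?N = 0" using True by (metis card.empty)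
    ultimately show ?thesis using c by (simp only: if_False)
  qed
qed

lemma card_pals_Nil: "card (pals ([] :: 'a list)) = 1"
proof -
  have "pals [] = {[] :: 'a list}" by (auto simp: pals_def palindrome_def)
  then show ?thesis by simp
qed

text \<open>The empty word contains one palindrome and each letter adds at most one, so the
  prescribed count is attained iff every letter adds one.\<close>

lemma rich_iff_new_palindromic_suffix:
  "rich u \<longleftrightarrow> (\<forall>r a. r @ [a] \<in> language u \<longrightarrow>
     (\<exists>p. suffix p (r @ [a]) \<and> palindrome p \<and> \<not> sublist p r))" (is "_ \<longleftrightarrow> ?R")
proof
  assume rich: "rich u"
  show ?R
  proof (intro allI impI)
    fix r a assume L: "r @ [a] \<in> language u"
    then have "r \<in> language u" by (rule snoc_in_languageD)
    then have "card (pals (r @ [a])) = card (pals r) + 1"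
      using L rich by (simp add: rich_def pals_def)
    then show "\<exists>p. suffix p (r @ [a]) \<and> palindrome p \<and> \<not> sublist p r"
      unfolding card_pals_snoc by (auto split: if_splits)
  qed
next
  assume R: ?R
  have "card (pals w) = length w + 1" if "w \<in> language u" for w
    using that
  proof (induction w rule: rev_induct)
    case (snoc a r)
    then have "r \<in> language u" by (blast dest: snoc_in_languageD)
    then show ?case using snoc R unfolding card_pals_snoc by auto
  qed (simp add: card_pals_Nil)
  then show "rich u" unfolding rich_def pals_def by blast
qed

text \<open>The last letter of the return adds a new palindromic suffix \<open>p\<close>. If
  \<open>p\<close> were shorter than \<open>n\<close>, it would lie in the word at \<open>j\<close>
  and, being a palindrome, also in the word at \<open>i\<close>. Otherwise \<open>p\<close> begins
  with a word of the class, which forces it to start at \<open>i\<close>.\<close>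

lemma rich_imp_palindromic_return:
  assumes rich: "rich u" and ij: "i < j" and eq: "cls (fac u j n) = cls (fac u i n)"
    and between: "\<And>k. i < k \<Longrightarrow> k < j \<Longrightarrow> cls (fac u k n) \<noteq> cls (fac u i n)"
  shows "rev (fac u i (j + n - i)) = fac u i (j + n - i)"
proof -
  define l where "l = j + n - i - 1"
  have l: "j + n - i = Suc l" "n \<le> l" "i + Suc l = j + n" using ij by (auto simp: l_def)
  have "fac u i l @ [u (i + l)] \<in> language u" unfolding fac_Suc_snoc[symmetric] by simp
  then obtain p where p: "suffix p (fac u i (Suc l))" "rev p = p" "\<not> sublist p (fac u i l)"
    using rich unfolding rich_iff_new_palindromic_suffix palindrome_def fac_Suc_snoc by blast
  define m where "m = length p"
  have m: "m \<le> Suc l" using p(1) suffix_length_le unfolding m_def by fastforce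
  obtain zs where zs: "fac u i (Suc l) = zs @ p"
    using p(1) by (auto simp: suffix_def)
  moreover have "Suc l = length zs + m"
    using arg_cong[OF zs, of length] by (simp add: m_def)
  ultimately have "p = drop (Suc l - m) (fac u i (Suc l))"
    by simp
  then have pf: "p = fac u (j + n - m) m" using m l by (simp add: drop_fac)
  show ?thesis
  proof (cases "n \<le> m")
    case True
    define s where "s = j + n - m"
    have s: "i \<le> s" "s \<le> j" "s + m = j + n" using True m l by (auto simp: s_def)
    \<comment> \<open>The left side is the word at \<open>j\<close>, because
      \<open>s + m = j + n\<close>. Its mirror image in \<open>p\<close> starts at \<open>s\<close>,
      and no word of the class starts strictly between \<open>i\<close> and
      \<open>j\<close>.\<close>
    have "fac u (s + m - n) n = rev (fac u s n)"
      by (rule palindrome_fac_ends) (use True p(2) pf in \<open>auto simp: s_def\<close>)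
    then have "cls (fac u s n) = cls (fac u i n)"
      using s eq by (simp add: cls_eq_iff)
    then consider "s = i" | "s = j" "s \<noteq> i" using between[of s] s by linarith
    then show ?thesis
    proof cases
      case 1
      then have "m = Suc l" using s l by simp
      then have "p = fac u i (Suc l)" using pf 1 by (simp add: s_def)
      then show ?thesis using p(2) l by simp
    next
      case 2
      then have "m = n" using s by simp
      then have "p = fac u j n" using pf by simp
      \<comment> \<open>If \<open>p\<close> is just the word at \<open>j\<close>, it already occurs
        at \<open>i\<close> and is not new.\<close>
      then have "fac u i n = p" using eq p(2) by (auto simp: cls_eq_iff)
      moreover have "sublist (fac u i n) (fac u i l)"
        by (rule sublist_fac_fac) (use l in auto)
      ultimately show ?thesis using p(3) by simp
    qed
  next
    case False
    have "suffix p (fac u j n)"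
    proof -
      have "fac u j n = fac u j (n - m) @ p"
        using fac_add[of u j "n - m" m] False pf by simp
      then show ?thesis by (simp add: suffix_def)
    qed
    then have "sublist p (fac u j n)" by (rule suffix_imp_sublist)
    moreover have "sublist (rev p) (rev (fac u j n))" using calculation by simp
    ultimately have "sublist p (fac u i n)" using eq p(2) by (auto simp: cls_eq_iff)
    moreover have "sublist (fac u i n) (fac u i l)"
      by (rule sublist_fac_fac) (use l in auto)
    ultimately show ?thesis using p(3) sublist_order.order.trans by blast
  qed
qed

text \<open>If the longest palindromic suffix had occurred before, the return from its last earlier
  occurrence would be a longer palindromic suffix.\<close>

lemma palindromic_returns_imp_rich:
  assumes ret: "\<And>n i j. i < j \<Longrightarrow> rev (fac u i n) = fac u i n \<Longrightarrow> fac u j n = fac u i n \<Longrightarrow>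
      (\<And>k. i < k \<Longrightarrow> k < j \<Longrightarrow> fac u k n \<noteq> fac u i n) \<Longrightarrow>
      rev (fac u i (j + n - i)) = fac u i (j + n - i)"
  shows "rich u"
  unfolding rich_iff_new_palindromic_suffix
proof (intro allI impI)
  fix r a assume "r @ [a] \<in> language u"
  then obtain i where "r @ [a] = fac u i (length (r @ [a]))" by (rule languageE)
  then obtain n where n: "r @ [a] = fac u i (Suc n)" "n = length r" by simp
  then have r: "r = fac u i n" by (simp add: fac_Suc_snoc)
  \<comment> \<open>\<open>P m\<close> says that the suffix of length \<open>m\<close> is a
    palindrome.\<close>
  define P where "P m \<longleftrightarrow> m \<le> Suc n \<and> rev (fac u (i + Suc n - m) m) = fac u (i + Suc n - m) m" for m
  define m where "m = (GREATEST m. P m)"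
  have "P 1" by (simp add: P_def fac_1)
  moreover have bound: "\<forall>y. P y \<longrightarrow> y \<le> Suc n" by (simp add: P_def)
  ultimately have Pm: "P m" "1 \<le> m"
    unfolding m_def by (blast intro: GreatestI_nat Greatest_le_nat)+
  have gr: "k \<le> m" if "P k" for k
    unfolding m_def using that bound by (blast intro: Greatest_le_nat)
  define t where "t = i + Suc n - m"
  define p where "p = fac u t m"
  have tm: "t + m = i + Suc n" "i \<le> t" using Pm by (auto simp: t_def P_def)
  have pal: "rev p = p" using Pm by (simp add: P_def p_def t_def)
  have "fac u i (Suc n) = fac u i (t - i) @ p"
    using fac_add[of u i "t - i" m] tm by (simp add: p_def)
  then have "suffix p (r @ [a])" using n by (simp add: suffix_def)
  moreover have "\<not> sublist p r"
  proof
    assume "sublist p r"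
    then obtain s0 where s0: "p = fac u s0 m" "i \<le> s0" "s0 + m \<le> i + n"
      unfolding r by (metis sublist_fac length_fac p_def)
    define Q where "Q s \<longleftrightarrow> s < t \<and> fac u s m = p" for s
    define s where "s = (GREATEST s. Q s)"
    have "Q s0" using s0 tm by (simp add: Q_def)
    moreover have bQ: "\<forall>y. Q y \<longrightarrow> y \<le> t" by (simp add: Q_def)
    ultimately have Qs: "Q s" "s0 \<le> s"
      unfolding s_def by (blast intro: GreatestI_nat Greatest_le_nat)+
    have grQ: "k \<le> s" if "Q k" for k
      unfolding s_def using that bQ by (blast intro: Greatest_le_nat)
    have "rev (fac u s (t + m - s)) = fac u s (t + m - s)"
      using Qs grQ pal by (intro ret) (auto simp: Q_def p_def dest: leD)
    moreover have "i \<le> s" "s < t" using s0 Qs by (auto simp: Q_def)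
    ultimately have "P (t + m - s)" unfolding P_def using tm by simp
    from gr[OF this] show False using \<open>s < t\<close> by simp
  qed
  ultimately show "\<exists>p. suffix p (r @ [a]) \<and> palindrome p \<and> \<not> sublist p r"
    using pal by (auto simp: palindrome_def)
qed

section \<open>From bilateral orders to richness\<close>

text \<open>Reversing a window of length \<open>m\<close> mirrors positions: offset \<open>s\<close>
  becomes offset \<open>m - s - n\<close> for a factor of length \<open>n\<close>.\<close>

lemma rev_fac_shift:
  assumes "rev (fac u a m) = fac u i m" "s + n \<le> m"
  shows "rev (fac u (a + s) n) = fac u (i + m - s - n) n"
proof -
  have "fac u (a + s) n = take n (drop s (fac u a m))"
    using assms(2) by (simp add: drop_fac take_fac)
  then have "rev (fac u (a + s) n) = drop (m - s - n) (take (m - s) (rev (fac u a m)))"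
    by (simp add: rev_take rev_drop)
  also have "\<dots> = fac u (i + (m - s - n)) (m - s - (m - s - n))"
    unfolding assms(1) using assms(2) by (simp add: take_fac drop_fac)
  also have "\<dots> = fac u (i + m - s - n) n"
    using assms(2) by simp
  finally show ?thesis .
qed

section \<open>The graph of classes of words of a given length\<close>

definition words :: "(nat \<Rightarrow> 'a) \<Rightarrow> nat \<Rightarrow> 'a list set" where
  "words u n = {w \<in> language u. length w = n}"

lemma words_eq: "words u n = range (\<lambda>i. fac u i n)"
  by (auto simp: words_def language_eq)

lemma walk_words:
  assumes "finite (words u n)" "finite (words u (Suc n))"
  shows "walk (\<lambda>i. cls (fac u i n)) (\<lambda>i. cls (fac u i (Suc n)))"
proof
  fix i j assume "cls (fac u i (Suc n)) = cls (fac u j (Suc n))"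
  from cls_ends[OF this]
  show "{cls (fac u i n), cls (fac u (Suc i) n)} = {cls (fac u j n), cls (fac u (Suc j) n)}"
    by simp
next
  show "finite (range (\<lambda>i. cls (fac u i n)))"
    using finite_imageI[OF assms(1), of cls] by (simp add: words_eq image_image)
  show "finite (range (\<lambda>i. cls (fac u i (Suc n))))"
    using finite_imageI[OF assms(2), of cls] by (simp add: words_eq image_image)
qed

lemma proper_step_iff:
  "cls (fac u i n) \<noteq> cls (fac u (Suc i) n) \<longleftrightarrow> rev (fac u i (Suc n)) \<noteq> fac u i (Suc n)"
proof -
  have "fac u i (Suc n) \<noteq> []" by (simp add: fac_Suc)
  from cls_butlast_eq_cls_tl_iff[OF this] show ?thesis by simp
qed

text \<open>If a complete return to a palindrome is not a palindrome, it has a longest prefix whose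
  reversal is a suffix; in the graph of that order the return leaves a vertex and comes back to it
  by two different edges.\<close>

lemma backtracking_imp_rich:
  assumes fin: "\<And>n. finite (words u n)"
    and bt: "\<And>n. walk.backtracking (\<lambda>i. cls (fac u i n)) (\<lambda>i. cls (fac u i (Suc n)))"
  shows "rich u"
proof (rule palindromic_returns_imp_rich)
  fix n i j assume ij: "i < j" and pal: "rev (fac u i n) = fac u i n" and eq: "fac u j n = fac u i n"
    and between: "\<And>k. i < k \<Longrightarrow> k < j \<Longrightarrow> fac u k n \<noteq> fac u i n"
  define l where "l = j + n - i"
  have l: "i + l = j + n" "n < l" using ij by (auto simp: l_def)
  \<comment> \<open>\<open>Q m\<close> says that the last \<open>m\<close> letters of the return
    mirror its first \<open>m\<close>.\<close>
  define Q where "Q m \<longleftrightarrow> m \<le> l \<and> fac u (i + l - m) m = rev (fac u i m)" for m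
  define m where "m = (GREATEST m. Q m)"
  have "Q n" using l eq pal by (simp add: Q_def)
  moreover have bQ: "\<forall>y. Q y \<longrightarrow> y \<le> l" by (simp add: Q_def)
  ultimately have Qm: "Q m" "n \<le> m"
    unfolding m_def by (blast intro: GreatestI_nat Greatest_le_nat)+
  have gr: "k \<le> m" if "Q k" for k
    unfolding m_def using that bQ by (blast intro: Greatest_le_nat)
  have "rev (fac u i l) = fac u i l"
  proof (cases "m = l")
    case True
    then show ?thesis using Qm by (simp add: Q_def)
  next
    case False
    then have ml: "m < l" using Qm by (simp add: Q_def)
    define t where "t = i + l - m"
    have t: "i < t" "t + m = j + n" "t \<le> j" using ml l Qm by (auto simp: t_def)
    have ft: "fac u t m = rev (fac u i m)" using Qm by (simp add: Q_def t_def)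
    let ?v = "\<lambda>i. cls (fac u i m)" and ?e = "\<lambda>i. cls (fac u i (Suc m))"
    \<comment> \<open>The words at \<open>i\<close> and at \<open>t\<close> begin and end,
      respectively, with the given palindrome. A copy of either at \<open>k\<close> would place this
      palindrome strictly between \<open>i\<close> and \<open>j\<close>.\<close>
    have nv: "?v k \<noteq> ?v i" if "i < k" "k < t" for k
    proof
      assume "?v k = ?v i"
      then consider "fac u k m = fac u i m" | "fac u k m = fac u t m"
        by (auto simp: cls_eq_iff ft)
      then show False
      proof cases
        case 1
        then have "take n (fac u k m) = take n (fac u i m)" by simp
        then have "fac u k n = fac u i n" using Qm by (simp add: take_fac)
        then show False using between[of k] that t by simp
      next
        case 2
        then have "drop (m - n) (fac u k m) = drop (m - n) (fac u t m)" by simp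
        then have "fac u (k + (m - n)) n = fac u (t + (m - n)) n" using Qm by (simp add: drop_fac)
        moreover have "t + (m - n) = j" using t Qm by simp
        moreover have "i < k + (m - n)" "k + (m - n) < j" using that calculation(2) by linarith+
        ultimately show False using between[of "k + (m - n)"] eq by simp
      qed
    qed
    show ?thesis
    proof (cases "?v i = ?v (Suc i)")
      case True
      \<comment> \<open>After an initial loop, \<open>nv\<close> leaves no room between
        \<open>i\<close> and \<open>t\<close>. The return is that single loop, hence a
        palindrome.\<close>
      then have "t = Suc i" using nv[of "Suc i"] t by (metis Suc_lessI lessI)
      then have "l = Suc m" using ml unfolding t_def by simp
      then show ?thesis using True proper_step_iff[of u i m] by simp
    next
      case False
      interpret walk ?v ?e by (rule walk_words[OF fin fin])
      have "?e (t - 1) = ?e i"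
        using t(1) False nv
        by (intro bt[of m, unfolded backtracking_def, rule_format]) (auto simp: ft)
      then consider "fac u (t - 1) (Suc m) = fac u i (Suc m)"
        | "fac u (t - 1) (Suc m) = rev (fac u i (Suc m))"
        by (auto simp: cls_eq_iff)
      then show ?thesis
      proof cases
        case 1
        \<comment> \<open>Read in the same direction, the edge would start at the vertex
          \<open>?v i\<close> again. Then \<open>t = Suc i\<close>, although the first step changes
          the vertex.\<close>
        then have "butlast (fac u (t - 1) (Suc m)) = butlast (fac u i (Suc m))" by simp
        then have "?v (t - 1) = ?v i" by simp
        then have "\<not> i < t - 1" using nv[of "t - 1"] t(1) by force
        then have "t = Suc i" using t(1) by linarith
        then show ?thesis using False ft by simp
      next
        case 2
        \<comment> \<open>Read in the opposite direction, the edge extends the mirrored ends by one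
          letter, against the maximality of \<open>m\<close>.\<close>
        then have "Q (Suc m)" using ml by (simp add: Q_def t_def)
        from gr[OF this] show ?thesis by simp
      qed
    qed
  qed
  then show "rev (fac u i (j + n - i)) = fac u i (j + n - i)" by (simp add: l_def)
qed

section \<open>Languages closed under reversal\<close>

locale reversal_closed_word =
  fixes A :: "'a set" and u :: "nat \<Rightarrow> 'a"
  assumes word: "infinite_word A u"
    and closed: "closed_under_reversal (language u)"
begin

lemma letter [simp]: "u i \<in> A"
  using word by (auto simp: infinite_word_def)

lemma finite_A: "finite A"
  using word by (simp add: infinite_word_def)

lemma letters_in_A: "w \<in> language u \<Longrightarrow> set w \<subseteq> A"
  by (auto simp: language_eq fac_def)

lemma finite_words: "finite (words u n)"
  by (rule finite_subset[OF _ finite_lists_length_eq[OF finite_A, of n]])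
    (use letters_in_A in \<open>auto simp: words_def\<close>)

lemma rev_in_language [simp]: "rev w \<in> language u \<longleftrightarrow> w \<in> language u"
  using closed unfolding closed_under_reversal_def by (metis rev_rev_ident)

text \<open>A reversed long prefix of \<open>u\<close> carries the reversal of an early factor near its end.\<close>

lemma recurrent:
  assumes "w \<in> language u"
  obtains i where "N \<le> i" "w = fac u i (length w)"
proof -
  obtain j where j: "rev w = fac u j (length w)"
    using assms by (metis languageE length_rev rev_in_language)
  \<comment> \<open>The mirror image of the occurrence at \<open>j\<close> starts at
    \<open>i + m - j - length w\<close>; the summand \<open>N\<close> moves it to \<open>N\<close>
    or later.\<close>
  define m where "m = j + length w + N"
  obtain i where "rev (fac u 0 m) = fac u i m"
    using languageE[of "rev (fac u 0 m)" u] by auto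
  then have "rev (fac u (0 + j) (length w)) = fac u (i + m - j - length w) (length w)"
    by (rule rev_fac_shift) (simp add: m_def)
  then have "w = fac u (i + m - j - length w) (length w)"
    using j by (metis add_0 rev_rev_ident)
  moreover have "N \<le> i + m - j - length w" by (simp add: m_def)
  ultimately show thesis using that by blast
qed

text \<open>Recurrence supplies an occurrence away from position 0, which has a preceding
  letter.\<close>

lemma left_extension:
  assumes "w \<in> language u" obtains a where "a \<in> A" "a # w \<in> language u"
proof -
  obtain i where i: "1 \<le> i" "w = fac u i (length w)" using recurrent[OF assms] .
  then have "u (i - 1) # w = fac u (i - 1) (Suc (length w))" by (simp add: fac_Suc)
  then show thesis using that[of "u (i - 1)"] by simp
qed

lemma right_extension:
  assumes "w \<in> language u" obtains a where "a \<in> A" "w @ [a] \<in> language u"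
proof -
  obtain i where i: "w = fac u i (length w)" using languageE[OF assms] .
  then have "w @ [u (i + length w)] = fac u i (Suc (length w))" by (simp add: fac_Suc_snoc)
  then show thesis using that[of "u (i + length w)"] by simp
qed

lemma card_words_classes:
  "2 * card (cls ` words u n) = card (words u n) + card {z \<in> words u n. rev z = z}"
  by (rule card_cls_image[OF finite_words]) (simp add: words_def)

lemma card_words_proper_classes:
  "2 * card (cls ` {z \<in> words u n. rev z \<noteq> z}) + card {z \<in> words u n. rev z = z} = card (words u n)"
proof -
  have "2 * card (cls ` {z \<in> words u n. rev z \<noteq> z}) = card {z \<in> words u n. rev z \<noteq> z}"
    by (rule card_cls_image_non_palindromes[OF finite_words]) (simp add: words_def)
  then show ?thesis
    using card_non_palindromes[OF finite_words, of n] by simp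
qed

text \<open>The assumption is twice the edge count of a tree: words plus palindromes of length
  \<open>n\<close> count each vertex twice, and words minus palindromes of length
  \<open>Suc n\<close> count each proper edge twice.\<close>

lemma complexity_equality_imp_rich:
  assumes "\<And>n. int (card (words u (Suc n))) - int (card (words u n)) + 2 =
    int (card {z \<in> words u n. rev z = z}) + int (card {z \<in> words u (Suc n). rev z = z})"
  shows "rich u"
proof (rule backtracking_imp_rich[OF finite_words])
  fix n
  interpret walk "\<lambda>i. cls (fac u i n)" "\<lambda>i. cls (fac u i (Suc n))"
    by (rule walk_words[OF finite_words finite_words])
  have "range (\<lambda>i. cls (fac u i n)) = cls ` words u n"
    by (auto simp: words_eq)
  moreover have "proper_edges = cls ` {z \<in> words u (Suc n). rev z \<noteq> z}"
    unfolding proper_edges_def proper_step_iff by (auto simp: words_eq)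
  ultimately show backtracking
    unfolding backtracking_iff
    using assms[of n] card_words_classes[of n] card_words_proper_classes[of "Suc n"] by simp
qed

section \<open>Counting extensions\<close>

lemma finite_ext: "finite (Lext A u w)" "finite (Rext A u w)" "finite (Bext A u w)" "finite (Pext A u w)"
proof -
  show "finite (Lext A u w)" "finite (Rext A u w)"
    using finite_A by (auto simp: Lext_def Rext_def)
  have "Bext A u w \<subseteq> words u (length w + 2)" "Pext A u w \<subseteq> words u (length w + 2)"
    by (auto simp: Bext_def Pext_def words_def)
  then show "finite (Bext A u w)" "finite (Pext A u w)"
    using finite_words finite_subset by blast+
qed

lemma words_Suc_Lext: "words u (Suc n) = (\<Union>w\<in>words u n. (\<lambda>a. a # w) ` Lext A u w)"
proof (intro set_eqI iffI)
  fix z assume z: "z \<in> words u (Suc n)"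
  then obtain a w where "z = a # w" by (cases z) (auto simp: words_def)
  moreover have "w \<in> language u" using z calculation by (auto simp: words_def dest: Cons_in_languageD)
  ultimately show "z \<in> (\<Union>w\<in>words u n. (\<lambda>a. a # w) ` Lext A u w)"
    using z letters_in_A[of z] by (auto simp: words_def Lext_def)
qed (auto simp: words_def Lext_def)

lemma words_Suc_Rext: "words u (Suc n) = (\<Union>w\<in>words u n. (\<lambda>a. w @ [a]) ` Rext A u w)"
proof (intro set_eqI iffI)
  fix z assume z: "z \<in> words u (Suc n)"
  then obtain a w where "z = w @ [a]" by (cases z rule: rev_cases) (auto simp: words_def)
  moreover have "w \<in> language u" using z calculation by (auto simp: words_def dest: snoc_in_languageD)
  ultimately show "z \<in> (\<Union>w\<in>words u n. (\<lambda>a. w @ [a]) ` Rext A u w)"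
    using z letters_in_A[of z] by (auto simp: words_def Rext_def)
qed (auto simp: words_def Rext_def)

lemma words_Suc_Suc_Bext: "words u (Suc (Suc n)) = (\<Union>w\<in>words u n. Bext A u w)"
proof (intro set_eqI iffI)
  fix z assume z: "z \<in> words u (Suc (Suc n))"
  then obtain a y where "z = a # y" "length y = Suc n" by (cases z) (auto simp: words_def)
  moreover then obtain w b where "y = w @ [b]" by (cases y rule: rev_cases) auto
  ultimately have zw: "z = a # w @ [b]" "length w = n" by auto
  then have "w \<in> language u"
    using z by (auto simp: words_def dest: Cons_in_languageD snoc_in_languageD)
  then show "z \<in> (\<Union>w\<in>words u n. Bext A u w)"
    using z zw letters_in_A[of z] by (auto simp: words_def Bext_def)
qed (auto simp: words_def Bext_def)

lemma palindromic_Bext_iff: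
  "z \<in> Bext A u w \<and> rev z = z \<longleftrightarrow> rev w = w \<and> z \<in> Pext A u w"
proof
  assume z: "z \<in> Bext A u w \<and> rev z = z"
  then obtain a b where ab: "z = a # w @ [b]" "a \<in> A" "z \<in> language u"
    by (auto simp: Bext_def)
  moreover have "rev (a # w @ [b]) = b # rev w @ [a]" by simp
  ultimately have "b # rev w @ [a] = a # w @ [b]" using z by metis
  then have "b = a" "rev w @ [a] = w @ [b]" by (simp_all only: list.inject)
  then show "rev w = w \<and> z \<in> Pext A u w" using ab by (simp add: Pext_def)
next
  assume z: "rev w = w \<and> z \<in> Pext A u w"
  then obtain a where "z = a # w @ [a]" "a \<in> A" "z \<in> language u"
    by (auto simp: Pext_def)
  then show "z \<in> Bext A u w \<and> rev z = z" using z by (simp add: Bext_def)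
qed

lemma palindromes_Suc_Suc_Pext:
  "{z \<in> words u (Suc (Suc n)). rev z = z} = (\<Union>w\<in>{w \<in> words u n. rev w = w}. Pext A u w)"
  unfolding words_Suc_Suc_Bext using palindromic_Bext_iff by blast

lemma sum_card_Lext: "(\<Sum>w\<in>words u n. card (Lext A u w)) = card (words u (Suc n))"
proof -
  have "card (words u (Suc n)) = (\<Sum>w\<in>words u n. card ((\<lambda>a. a # w) ` Lext A u w))"
    unfolding words_Suc_Lext by (rule card_UN_disjoint) (auto simp: finite_words finite_ext)
  then show ?thesis by (simp add: card_image inj_on_def)
qed

lemma sum_card_Rext: "(\<Sum>w\<in>words u n. card (Rext A u w)) = card (words u (Suc n))"
proof -
  have "card (words u (Suc n)) = (\<Sum>w\<in>words u n. card ((\<lambda>a. w @ [a]) ` Rext A u w))"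
    unfolding words_Suc_Rext by (rule card_UN_disjoint) (auto simp: finite_words finite_ext)
  then show ?thesis by (simp add: card_image inj_on_def)
qed

lemma sum_card_Bext: "(\<Sum>w\<in>words u n. card (Bext A u w)) = card (words u (Suc (Suc n)))"
  unfolding words_Suc_Suc_Bext
proof (rule card_UN_disjoint[symmetric])
  have "Bext A u w \<inter> Bext A u w' = {}" if "w \<noteq> w'" for w w'
    using that by (auto simp: Bext_def)
  then show "\<forall>w\<in>words u n. \<forall>w'\<in>words u n. w \<noteq> w' \<longrightarrow> Bext A u w \<inter> Bext A u w' = {}"
    by simp
qed (simp_all add: finite_words finite_ext)

lemma sum_card_Pext:
  "(\<Sum>w\<in>{w \<in> words u n. rev w = w}. card (Pext A u w)) = card {z \<in> words u (Suc (Suc n)). rev z = z}"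
  unfolding palindromes_Suc_Suc_Pext
proof (rule card_UN_disjoint[symmetric])
  have "Pext A u w \<inter> Pext A u w' = {}" if "w \<noteq> w'" for w w'
    using that by (auto simp: Pext_def)
  then show "\<forall>w\<in>{w \<in> words u n. rev w = w}. \<forall>w'\<in>{w \<in> words u n. rev w = w}. w \<noteq> w' \<longrightarrow> Pext A u w \<inter> Pext A u w' = {}"
    by simp
qed (simp_all add: finite_words finite_ext)

lemma Rext_palindrome:
  assumes "rev w = w"
  shows "Rext A u w = Lext A u w"
proof -
  have "w @ [a] \<in> language u \<longleftrightarrow> a # w \<in> language u" for a
    using rev_in_language[of "a # w"] assms by simp
  then show ?thesis by (simp add: Rext_def Lext_def)
qed

text \<open>Stated for arbitrary words, so that it can be summed over all factors of one length,
  bispecial or not.\<close>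

definition bilateral_condition :: "'a list \<Rightarrow> bool" where
  "bilateral_condition w \<longleftrightarrow>
     bilateral_order A u w = (if rev w = w then int (card (Pext A u w)) - 1 else 0)"

text \<open>Every \<open>w @ [b]\<close> in the language extends to the left, and only by
  \<open>a\<close>, so the two-sided extensions correspond to the right ones.\<close>

lemma bilateral_order_card_Lext_1:
  assumes L: "Lext A u w = {a}"
  shows "bilateral_order A u w = 0"
proof -
  have "Bext A u w = (\<lambda>b. a # w @ [b]) ` Rext A u w"
  proof (intro set_eqI iffI)
    fix z assume "z \<in> Bext A u w"
    then obtain c b where z: "z = c # w @ [b]" "z \<in> language u" "c \<in> A" "b \<in> A"
      by (auto simp: Bext_def)
    have "c # w \<in> language u" "w @ [b] \<in> language u"
      using z(2) snoc_in_languageD[of "c # w" b] Cons_in_languageD[of c "w @ [b]"] unfolding z(1) by simp_all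
    then have "c \<in> Lext A u w" "b \<in> Rext A u w"
      using z by (auto simp: Lext_def Rext_def)
    then show "z \<in> (\<lambda>b. a # w @ [b]) ` Rext A u w"
      using L z by auto
  next
    fix z assume "z \<in> (\<lambda>b. a # w @ [b]) ` Rext A u w"
    then obtain b where b: "z = a # w @ [b]" "b \<in> A" "w @ [b] \<in> language u"
      by (auto simp: Rext_def)
    obtain c where c: "c \<in> A" "c # w @ [b] \<in> language u"
      using left_extension[OF b(3)] .
    then have "c # w \<in> language u" using snoc_in_languageD[of "c # w" b] by simp
    then have "c = a" using L c by (auto simp: Lext_def)
    then show "z \<in> Bext A u w" using b c by (auto simp: Bext_def)
  qed
  then have "card (Bext A u w) = card (Rext A u w)"
    by (simp add: card_image inj_on_def)
  then show ?thesis using L by (simp add: bilateral_order_def)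
qed

lemma bilateral_order_card_Rext_1:
  assumes R: "Rext A u w = {b}"
  shows "bilateral_order A u w = 0"
proof -
  have "Bext A u w = (\<lambda>a. a # w @ [b]) ` Lext A u w"
  proof (intro set_eqI iffI)
    fix z assume "z \<in> Bext A u w"
    then obtain a c where z: "z = a # w @ [c]" "z \<in> language u" "a \<in> A" "c \<in> A"
      by (auto simp: Bext_def)
    have "a # w \<in> language u" "w @ [c] \<in> language u"
      using z(2) snoc_in_languageD[of "a # w" c] Cons_in_languageD[of a "w @ [c]"] unfolding z(1) by simp_all
    then have "a \<in> Lext A u w" "c \<in> Rext A u w"
      using z by (auto simp: Lext_def Rext_def)
    then show "z \<in> (\<lambda>a. a # w @ [b]) ` Lext A u w"
      using R z by auto
  next
    fix z assume "z \<in> (\<lambda>a. a # w @ [b]) ` Lext A u w"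
    then obtain a where a: "z = a # w @ [b]" "a \<in> A" "a # w \<in> language u"
      by (auto simp: Lext_def)
    obtain c where c: "c \<in> A" "(a # w) @ [c] \<in> language u"
      using right_extension[OF a(3)] .
    then have "w @ [c] \<in> language u" using Cons_in_languageD[of a "w @ [c]"] by simp
    then have "c = b" using R c by (auto simp: Rext_def)
    then show "z \<in> Bext A u w" using R a c by (auto simp: Bext_def Rext_def)
  qed
  then have "card (Bext A u w) = card (Lext A u w)"
    by (simp add: card_image inj_on_def)
  then show ?thesis using R by (simp add: bilateral_order_def)
qed

text \<open>One extension set is a singleton, so the order vanishes. For a palindrome both sets are
  the same singleton, and its letter gives the only palindromic extension.\<close>

lemma bilateral_condition_non_bispecial:
  assumes w: "w \<in> language u" and nb: "\<not> bispecial A u w"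
  shows "bilateral_condition w"
proof -
  have "Lext A u w \<noteq> {}" using left_extension[OF w] by (auto simp: Lext_def)
  moreover have "Rext A u w \<noteq> {}" using right_extension[OF w] by (auto simp: Rext_def)
  moreover have "card (Lext A u w) < 2 \<or> card (Rext A u w) < 2"
    using w nb by (auto simp: bispecial_def)
  moreover have "card (Lext A u w) \<noteq> 0" "card (Rext A u w) \<noteq> 0"
    using calculation(1,2) finite_ext(1,2)[of w] by simp_all
  ultimately have "card (Lext A u w) = 1 \<or> card (Rext A u w) = 1"
    by linarith
  then have one: "(\<exists>a. Lext A u w = {a}) \<or> (\<exists>b. Rext A u w = {b})"
    by (auto simp: card_1_singleton_iff)
  then have b: "bilateral_order A u w = 0"
    using bilateral_order_card_Lext_1 bilateral_order_card_Rext_1 by blast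
  show ?thesis
  proof (cases "rev w = w")
    case True
    then obtain a where a: "Lext A u w = {a}" "Rext A u w = {a}"
      using one Rext_palindrome[OF True] by auto
    then have aw: "a \<in> A" "a # w \<in> language u" by (auto simp: Lext_def)
    obtain c where c: "c \<in> A" "(a # w) @ [c] \<in> language u"
      using right_extension[OF aw(2)] .
    then have "w @ [c] \<in> language u" using Cons_in_languageD[of a "w @ [c]"] by simp
    then have "c = a" using a c by (auto simp: Rext_def)
    then have "a # w @ [a] \<in> language u" using c by simp
    moreover have "x = a" if "x # w @ [x] \<in> language u" "x \<in> A" for x
    proof -
      have "x # w \<in> language u" using that(1) snoc_in_languageD[of "x # w" x] by simp
      then show ?thesis using a that by (auto simp: Lext_def)
    qed
    ultimately have "Pext A u w = {a # w @ [a]}" using aw(1) unfolding Pext_def by blast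
    then show ?thesis using b by (simp add: bilateral_condition_def)
  qed (use b in \<open>simp add: bilateral_condition_def\<close>)
qed

lemma bilateral_condition_imp_rich:
  assumes cond: "\<And>w. w \<in> language u \<Longrightarrow> bilateral_condition w"
  shows "rich u"
proof (rule complexity_equality_imp_rich)
  fix n
  let ?C = "\<lambda>n. int (card (words u n))" and ?P = "\<lambda>n. int (card {z \<in> words u n. rev z = z})"
  \<comment> \<open>Each word of length \<open>n + 2\<close> extends exactly one word of length
    \<open>n\<close> on both sides, and it is a palindrome iff it is a palindromic extension of a
    palindrome.\<close>
  have second_difference: "?C (Suc (Suc n)) - 2 * ?C (Suc n) + ?C n = ?P (Suc (Suc n)) - ?P n" for n
  proof -
    have "(\<Sum>w\<in>words u n. bilateral_order A u w) =
      (\<Sum>w\<in>words u n. if rev w = w then int (card (Pext A u w)) - 1 else 0)"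
      using cond by (intro sum.cong) (auto simp: words_def bilateral_condition_def)
    also have "\<dots> = (\<Sum>w\<in>{w \<in> words u n. rev w = w}. int (card (Pext A u w)) - 1)"
      by (simp add: sum.inter_filter[OF finite_words])
    also have "\<dots> = int (\<Sum>w\<in>{w \<in> words u n. rev w = w}. card (Pext A u w)) - ?P n"
      by (simp add: sum_subtractf)
    also have "\<dots> = ?P (Suc (Suc n)) - ?P n"
      by (simp only: sum_card_Pext)
    finally have "(\<Sum>w\<in>words u n. bilateral_order A u w) = ?P (Suc (Suc n)) - ?P n" .
    moreover have "(\<Sum>w\<in>words u n. bilateral_order A u w) =
      int (\<Sum>w\<in>words u n. card (Bext A u w)) - int (\<Sum>w\<in>words u n. card (Rext A u w))
      - int (\<Sum>w\<in>words u n. card (Lext A u w)) + ?C n"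
      by (simp add: bilateral_order_def sum_subtractf sum.distrib)
    ultimately show ?thesis
      unfolding sum_card_Bext sum_card_Rext sum_card_Lext by simp
  qed
  show "?C (Suc n) - ?C n + 2 = ?P n + ?P (Suc n)"
  proof (induction n)
    case 0
    \<comment> \<open>Both sides equal the number of letters plus 1, since all letters are
      palindromes.\<close>
    have "words u 0 = {[]}" "{z \<in> words u 0. rev z = z} = {[]}"
      by (auto simp: words_eq)
    moreover have "{z \<in> words u (Suc 0). rev z = z} = words u (Suc 0)"
      by (auto simp: words_eq fac_1)
    ultimately show ?case by simp
  next
    case (Suc n)
    then show ?case using second_difference[of n] by simp
  qed
qed

end

section \<open>From richness to bilateral orders\<close>

locale rich_factor = reversal_closed_word +
  fixes w :: "'a list"
  assumes rich: "rich u" and factor: "w \<in> language u"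
begin

text \<open>The word in the class of \<open>w\<close> starts at \<open>Suc i\<close>, so it has a
  left neighbour and the edge \<open>awb\<close> starts at \<open>i\<close>.\<close>

definition occ :: "nat \<Rightarrow> bool" where
  "occ i \<longleftrightarrow> cls (fac u (Suc i) (length w)) = cls w"

definition next_occ :: "nat \<Rightarrow> nat" where
  "next_occ i = (LEAST t. i \<le> t \<and> occ t)"

text \<open>Between two occurrences the walk waits at a vertex; \<open>{}\<close>, which is not the class of any word,
  marks these idle steps.\<close>

definition vtx :: "nat \<Rightarrow> 'a list set" where
  "vtx i = cls (fac u (next_occ i) (Suc (length w)))"

definition edge :: "nat \<Rightarrow> 'a list set" where
  "edge i = (if occ i then cls (fac u i (Suc (Suc (length w)))) else {})"

lemma next_occ: "i \<le> next_occ i" "occ (next_occ i)"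
proof -
  obtain t where t: "Suc i \<le> t" "w = fac u t (length w)" using recurrent[OF factor] .
  then have "i \<le> t - 1 \<and> occ (t - 1)" by (simp add: occ_def)
  then have "i \<le> next_occ i \<and> occ (next_occ i)"
    unfolding next_occ_def by (rule LeastI)
  then show "i \<le> next_occ i" "occ (next_occ i)" by auto
qed

lemma next_occ_le: "i \<le> t \<Longrightarrow> occ t \<Longrightarrow> next_occ i \<le> t"
  unfolding next_occ_def by (rule Least_le) simp

lemma next_occ_self: "occ i \<Longrightarrow> next_occ i = i"
  using next_occ(1)[of i] next_occ_le[of i i] by simp

lemma next_occ_Suc:
  assumes "\<not> occ i" shows "next_occ (Suc i) = next_occ i"
proof (rule antisym)
  have "next_occ i \<noteq> i" using assms next_occ(2)[of i] by auto
  then show "next_occ (Suc i) \<le> next_occ i"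
    using next_occ[of i] by (intro next_occ_le) auto
  show "next_occ i \<le> next_occ (Suc i)"
    using next_occ[of "Suc i"] by (intro next_occ_le) auto
qed

lemma vtx_occ: "occ i \<Longrightarrow> vtx i = cls (fac u i (Suc (length w)))"
  by (simp add: vtx_def next_occ_self)

lemma vtx_Suc: "\<not> occ i \<Longrightarrow> vtx (Suc i) = vtx i"
  by (simp add: vtx_def next_occ_Suc)

text \<open>The return from an occurrence to the next one is a palindrome, so it enters the next
  occurrence through the vertex by which it left the first one.\<close>

lemma vtx_Suc_occ:
  assumes "occ i"
  shows "vtx (Suc i) = cls (fac u (Suc i) (Suc (length w)))"
proof -
  let ?n = "length w" and ?j = "next_occ (Suc i)"
  have j: "Suc i \<le> ?j" "occ ?j" using next_occ by auto
  have "rev (fac u (Suc i) (Suc ?j + ?n - Suc i)) = fac u (Suc i) (Suc ?j + ?n - Suc i)"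
  proof (rule rich_imp_palindromic_return[OF rich])
    show "cls (fac u (Suc ?j) ?n) = cls (fac u (Suc i) ?n)"
      using j(2) assms by (simp add: occ_def)
    fix k assume k: "Suc i < k" "k < Suc ?j"
    show "cls (fac u k ?n) \<noteq> cls (fac u (Suc i) ?n)"
    proof
      assume "cls (fac u k ?n) = cls (fac u (Suc i) ?n)"
      then have "occ (k - 1)" using assms k by (simp add: occ_def)
      then have "?j \<le> k - 1" using k by (intro next_occ_le) auto
      then show False using k by simp
    qed
  qed (use j in simp)
  \<comment> \<open>The palindrome runs from \<open>Suc i\<close> to the end of the word at
    \<open>Suc ?j\<close>; its last \<open>Suc ?n\<close> letters start at
    \<open>?j\<close>.\<close>
  from palindrome_fac_ends[OF this, of "Suc ?n"] j(1)
  have "fac u ?j (Suc ?n) = rev (fac u (Suc i) (Suc ?n))" by simp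
  then show ?thesis by (simp add: vtx_def)
qed

lemma proper_iff:
  "vtx i \<noteq> vtx (Suc i) \<longleftrightarrow> occ i \<and> rev (fac u i (Suc (Suc (length w)))) \<noteq> fac u i (Suc (Suc (length w)))"
  using proper_step_iff[of u i "Suc (length w)"] by (cases "occ i") (simp_all add: vtx_occ vtx_Suc_occ vtx_Suc)

lemma range_vtx:
  "range vtx = cls ` {z \<in> words u (Suc (length w)). cls (tl z) = cls w}"
proof (intro set_eqI iffI)
  fix x assume "x \<in> range vtx"
  then obtain i where "x = cls (fac u (next_occ i) (Suc (length w)))" by (auto simp: vtx_def)
  then show "x \<in> cls ` {z \<in> words u (Suc (length w)). cls (tl z) = cls w}"
    using next_occ(2)[of i] by (auto simp: words_eq occ_def)
next
  fix x assume "x \<in> cls ` {z \<in> words u (Suc (length w)). cls (tl z) = cls w}"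
  then obtain i where i: "x = cls (fac u i (Suc (length w)))" "cls (fac u (Suc i) (length w)) = cls w"
    by (auto simp: words_eq)
  then have "x = vtx i" by (simp add: vtx_occ occ_def)
  then show "x \<in> range vtx" by simp
qed

lemma proper_edges_eq:
  "edge ` {i. vtx i \<noteq> vtx (Suc i)} =
    cls ` {z \<in> words u (Suc (Suc (length w))). cls (tl (butlast z)) = cls w \<and> rev z \<noteq> z}"
proof -
  have "edge ` {i. vtx i \<noteq> vtx (Suc i)} = (\<lambda>i. cls (fac u i (Suc (Suc (length w))))) `
     {i. cls (tl (butlast (fac u i (Suc (Suc (length w)))))) = cls w \<and>
        rev (fac u i (Suc (Suc (length w)))) \<noteq> fac u i (Suc (Suc (length w)))}"
    unfolding proper_iff by (intro image_cong) (auto simp: occ_def edge_def)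
  then show ?thesis by (auto simp: words_eq)
qed

sublocale walk vtx edge
proof
  fix i j assume eq: "edge i = edge j" and ne: "vtx i \<noteq> vtx (Suc i)"
  have i: "occ i" using ne vtx_Suc by metis
  \<comment> \<open>The label \<open>{}\<close> of idle steps is not a class, so an occurrence
    shares its label only with occurrences.\<close>
  have j: "occ j"
  proof (rule ccontr)
    assume "\<not> occ j"
    then have "cls (fac u i (Suc (Suc (length w)))) = {}" using eq i by (simp add: edge_def)
    then show False by (simp add: cls_def)
  qed
  have "cls (fac u i (Suc (Suc (length w)))) = cls (fac u j (Suc (Suc (length w))))"
    using eq i j by (simp add: edge_def)
  from cls_ends[OF this] show "{vtx i, vtx (Suc i)} = {vtx j, vtx (Suc j)}"
    using i j by (simp add: vtx_occ vtx_Suc_occ)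
next
  show "finite (range vtx)" unfolding range_vtx using finite_words by simp
  have "range edge \<subseteq> insert {} (cls ` words u (Suc (Suc (length w))))"
    by (auto simp: edge_def words_eq)
  then show "finite (range edge)" by (rule finite_subset) (simp add: finite_words)
qed

text \<open>Returning to a vertex first at time \<open>j\<close> is a complete return to a class of
  words of length \<open>length w + 1\<close>. It is a palindrome, so its last
  \<open>length w + 2\<close> letters mirror the first ones and form the same edge.\<close>

lemma backtracking: backtracking
  unfolding backtracking_def
proof (intro allI impI)
  let ?n = "Suc (length w)"
  fix k j assume kj: "k < j" and ne: "vtx k \<noteq> vtx (Suc k)" and ret: "vtx j = vtx k"
    and between: "\<forall>i. k < i \<and> i < j \<longrightarrow> vtx i \<noteq> vtx k"
  have k: "occ k" using ne vtx_Suc by metis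
  have "j \<noteq> Suc k" using ne ret by auto
  then have "Suc k < j" using kj by simp
  then obtain t where t: "j = Suc t" "k < t" by (cases j) auto
  have "vtx t \<noteq> vtx (Suc t)" using between t ret by auto
  then have occ_t: "occ t" using vtx_Suc by metis
  have vk: "vtx k = cls (fac u k ?n)" using k by (rule vtx_occ)
  have "rev (fac u k (Suc t + ?n - k)) = fac u k (Suc t + ?n - k)"
  proof (rule rich_imp_palindromic_return[OF rich])
    show "k < Suc t" using t by simp
    show "cls (fac u (Suc t) ?n) = cls (fac u k ?n)"
      using ret vk vtx_Suc_occ[OF occ_t] t by simp
    fix p assume p: "k < p" "p < Suc t"
    show "cls (fac u p ?n) \<noteq> cls (fac u k ?n)"
    proof
      assume eq: "cls (fac u p ?n) = cls (fac u k ?n)"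
      have "cls (fac u (Suc k) (length w)) = cls w" using k by (simp add: occ_def)
      \<comment> \<open>A copy of the vertex at \<open>p\<close> has a word of the class of
        \<open>w\<close> at one of its ends. The walk thus stands at this vertex at time
        \<open>p\<close>, either leaving it or having just arrived.\<close>
      then have "cls (fac u (Suc p) (length w)) = cls w \<or> cls (fac u p (length w)) = cls w"
        using cls_ends[OF eq] by (auto simp: doubleton_eq_iff)
      then have "vtx p = cls (fac u p ?n)"
      proof
        assume "cls (fac u (Suc p) (length w)) = cls w"
        then show ?thesis by (intro vtx_occ) (simp add: occ_def)
      next
        assume "cls (fac u p (length w)) = cls w"
        then have "occ (p - 1)" using p by (simp add: occ_def)
        from vtx_Suc_occ[OF this] show ?thesis using p by simp
      qed
      then have "vtx p = vtx k" using eq vk by simp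
      then show False using between p t by simp
    qed
  qed
  from palindrome_fac_ends[OF this, of "Suc ?n"] t
  have "fac u t (Suc ?n) = rev (fac u k (Suc ?n))" by simp
  then show "edge (j - 1) = edge k" using k occ_t t by (simp add: edge_def)
qed

section \<open>Counting the edges and vertices at a factor\<close>

lemma card_edges_vertices:
  "Suc (card (cls ` {z \<in> words u (Suc (Suc (length w))). cls (tl (butlast z)) = cls w \<and> rev z \<noteq> z})) =
   card (cls ` {z \<in> words u (Suc (length w)). cls (tl z) = cls w})"
  using backtracking unfolding backtracking_iff proper_edges_def proper_edges_eq range_vtx .

text \<open>A word with tail \<open>rev w\<close> is the reversal of a right extension of
  \<open>w\<close>.\<close>

lemma vertices_eq:
  "cls ` {z \<in> words u (Suc (length w)). cls (tl z) = cls w} =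
    cls ` ((\<lambda>a. a # w) ` Lext A u w) \<union> cls ` ((\<lambda>a. w @ [a]) ` Rext A u w)" (is "?L = ?R")
proof
  show "?L \<subseteq> ?R"
  proof
    fix x assume "x \<in> ?L"
    then obtain z where z: "x = cls z" "z \<in> language u" "length z = Suc (length w)" "cls (tl z) = cls w"
      by (auto simp: words_def)
    then obtain a y where ay: "z = a # y" by (cases z) auto
    then have "a \<in> A" using letters_in_A[OF z(2)] by auto
    have "y = w \<or> y = rev w" using z(4) ay by (simp add: cls_eq_iff)
    then show "x \<in> ?R"
    proof
      assume "y = w"
      then have "a \<in> Lext A u w" using z(2) ay \<open>a \<in> A\<close> by (simp add: Lext_def)
      then show ?thesis using z(1) ay \<open>y = w\<close> by auto
    next
      assume "y = rev w"
      then have "rev z = w @ [a]" using ay by simp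
      then have "a \<in> Rext A u w" using z(2) \<open>a \<in> A\<close> by (metis (mono_tags) Rext_def mem_Collect_eq rev_in_language)
      moreover have "x = cls (w @ [a])" using z(1) \<open>rev z = w @ [a]\<close> by (metis cls_rev)
      ultimately show ?thesis by auto
    qed
  qed
  show "?R \<subseteq> ?L"
  proof
    fix x assume "x \<in> ?R"
    then consider a where "x = cls (a # w)" "a # w \<in> language u"
      | a where "x = cls (a # rev w)" "a # rev w \<in> language u"
    proof
      assume "x \<in> cls ` ((\<lambda>a. w @ [a]) ` Rext A u w)"
      then obtain a where "x = cls (w @ [a])" "w @ [a] \<in> language u" by (auto simp: Rext_def)
      then have "x = cls (a # rev w)" "a # rev w \<in> language u"
        using cls_rev[of "w @ [a]"] rev_in_language[of "w @ [a]"] by simp_all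
      then show thesis using that by blast
    qed (auto simp: Lext_def)
    then show "x \<in> ?L"
    proof cases
      case 1
      then show ?thesis by (intro image_eqI[of _ _ "a # w"]) (simp_all add: words_def)
    next
      case 2
      then show ?thesis by (intro image_eqI[of _ _ "a # rev w"]) (simp_all add: words_def)
    qed
  qed
qed

lemma card_cls_Lext: "card (cls ` ((\<lambda>a. a # w) ` Lext A u w)) = card (Lext A u w)"
proof -
  have "inj_on (\<lambda>a. cls (a # w)) (Lext A u w)"
    by (rule inj_onI) (auto simp: cls_eq_iff dest: Cons_eq_rev_snoc)
  then show ?thesis by (simp add: image_image card_image)
qed

lemma card_cls_Rext: "card (cls ` ((\<lambda>a. w @ [a]) ` Rext A u w)) = card (Rext A u w)"
proof -
  have "inj_on (\<lambda>a. cls (w @ [a])) (Rext A u w)"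
  proof (rule inj_onI)
    fix x y assume "cls (w @ [x]) = cls (w @ [y])"
    then have "x = y \<or> y # rev w = rev (rev w) @ [x]"
      by (auto simp: cls_eq_iff)
    then show "x = y"
      using Cons_eq_rev_snoc by metis
  qed
  then show ?thesis by (simp add: image_image card_image)
qed

text \<open>A two-sided extension of \<open>rev w\<close> is the reversal of one of
  \<open>w\<close>.\<close>

lemma edges_eq:
  "cls ` {z \<in> words u (Suc (Suc (length w))). cls (tl (butlast z)) = cls w \<and> rev z \<noteq> z} =
    cls ` {z \<in> Bext A u w. rev z \<noteq> z}" (is "?L = ?R")
proof
  show "?L \<subseteq> ?R"
  proof
    fix x assume "x \<in> ?L"
    then obtain z where z: "x = cls z" "z \<in> words u (Suc (Suc (length w)))"
      "cls (tl (butlast z)) = cls w" "rev z \<noteq> z" by auto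
    then obtain y where y: "y \<in> words u (length w)" "z \<in> Bext A u y"
      by (auto simp: words_Suc_Suc_Bext)
    then have "tl (butlast z) = y" by (auto simp: Bext_def butlast_append)
    then have "y = w \<or> y = rev w" using z(3) by (simp add: cls_eq_iff)
    then show "x \<in> ?R"
    proof
      assume "y = rev w"
      then obtain a b where ab: "z = a # rev w @ [b]" "a \<in> A" "b \<in> A" "z \<in> language u"
        using y(2) by (auto simp: Bext_def)
      then have "rev z \<in> Bext A u w"
        using rev_in_language[of z] by (simp add: Bext_def)
      moreover have "rev (rev z) \<noteq> rev z" using z(4) by simp
      ultimately have "cls (rev z) \<in> ?R" by blast
      then show ?thesis using z(1) by simp
    qed (use y z in auto)
  qed
  show "?R \<subseteq> ?L"
    by (intro image_mono) (auto simp: Bext_def words_def butlast_append)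
qed

text \<open>Left and right extensions have the same classes, so there are
  \<open>card (Lext A u w)\<close> vertices. Non-palindromic two-sided extensions pair up under
  reversal, and the rest are the palindromic extensions.\<close>

lemma bilateral_order_palindrome:
  assumes pal: "rev w = w"
  shows "bilateral_order A u w = int (card (Pext A u w)) - 1"
proof -
  have "(\<lambda>a. cls (w @ [a])) ` Rext A u w = (\<lambda>a. cls (a # w)) ` Lext A u w"
    using cls_rev[of "_ # w"] pal by (simp add: Rext_palindrome)
  then have "Suc (card (cls ` {z \<in> Bext A u w. rev z \<noteq> z})) = card (Lext A u w)"
    using card_edges_vertices card_cls_Lext unfolding edges_eq vertices_eq
    by (simp add: image_image)
  moreover have "2 * card (cls ` {z \<in> Bext A u w. rev z \<noteq> z}) = card {z \<in> Bext A u w. rev z \<noteq> z}"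
  proof (rule card_cls_image_non_palindromes[OF finite_ext(3)])
    fix z assume "z \<in> Bext A u w"
    then obtain a b where "z = a # w @ [b]" "a \<in> A" "b \<in> A" "z \<in> language u"
      by (auto simp: Bext_def)
    then show "rev z \<in> Bext A u w"
      using rev_in_language[of z] pal by (simp add: Bext_def)
  qed
  moreover have "Pext A u w = {z \<in> Bext A u w. rev z = z}"
    using palindromic_Bext_iff[of _ w] pal by blast
  moreover have "card (Bext A u w) = card {z \<in> Bext A u w. rev z \<noteq> z} + card {z \<in> Bext A u w. rev z = z}"
    by (rule card_non_palindromes[OF finite_ext(3)])
  ultimately show ?thesis
    unfolding \<open>Pext A u w = _\<close> bilateral_order_def Rext_palindrome[OF pal] by linarith
qed

text \<open>No identification takes place: left and right extensions have different classes, and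
  distinct two-sided extensions are distinct proper edges.\<close>

lemma bilateral_order_non_palindrome:
  assumes non_pal: "rev w \<noteq> w"
  shows "bilateral_order A u w = 0"
proof -
  have "cls (a # w) \<noteq> cls (w @ [b])" for a b
    using non_pal Cons_eq_snoc_imp_rev[of a w b] by (auto simp: cls_eq_iff)
  then have "cls ` ((\<lambda>a. a # w) ` Lext A u w) \<inter> cls ` ((\<lambda>a. w @ [a]) ` Rext A u w) = {}"
    by (auto simp: image_image)
  then have "Suc (card (cls ` {z \<in> Bext A u w. rev z \<noteq> z})) = card (Lext A u w) + card (Rext A u w)"
    using card_edges_vertices unfolding edges_eq vertices_eq
    by (simp add: card_Un_disjoint finite_ext card_cls_Lext card_cls_Rext)
  moreover have "{z \<in> Bext A u w. rev z \<noteq> z} = Bext A u w"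
    using non_pal by (auto simp: Bext_def)
  moreover have "inj_on cls (Bext A u w)"
    using non_pal by (auto simp: inj_on_def Bext_def cls_eq_iff)
  ultimately show ?thesis
    by (simp add: bilateral_order_def card_image)
qed

end

theorem theorem11:
  fixes A :: "'a set" and u :: "nat \<Rightarrow> 'a"
  assumes "infinite_word A u"
    and "closed_under_reversal (language u)"
  shows "rich u \<longleftrightarrow>
    (\<forall>w. bispecial A u w \<longrightarrow>
      (\<not> palindrome w \<longrightarrow> bilateral_order A u w = 0) \<and>
      (palindrome w \<longrightarrow> bilateral_order A u w = int (card (Pext A u w)) - 1))"
proof -
  interpret reversal_closed_word A u
    using assms by unfold_locales
  show ?thesis
  proof (intro iffI allI impI)
    fix w assume "rich u" "bispecial A u w"
    then have "w \<in> language u" by (simp add: bispecial_def)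
    interpret rich_factor A u w
      by unfold_locales fact+
    show "(\<not> palindrome w \<longrightarrow> bilateral_order A u w = 0) \<and>
      (palindrome w \<longrightarrow> bilateral_order A u w = int (card (Pext A u w)) - 1)"
      using bilateral_order_palindrome bilateral_order_non_palindrome by (simp add: palindrome_def)
  next
    assume cond: "\<forall>w. bispecial A u w \<longrightarrow>
      (\<not> palindrome w \<longrightarrow> bilateral_order A u w = 0) \<and>
      (palindrome w \<longrightarrow> bilateral_order A u w = int (card (Pext A u w)) - 1)"
    show "rich u"
    proof (rule bilateral_condition_imp_rich)
      fix w assume "w \<in> language u"
      then show "bilateral_condition w"
        using cond bilateral_condition_non_bispecial[of w]
        by (cases "bispecial A u w") (auto simp: bilateral_condition_def palindrome_def)
    qed
  qed
qed

end
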